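(* Given an additive quality function $Q$ (with elementary function $q$) and a dendrogram on a vertex set $V$ with $n$ vertices, it is possible to find a partition $\mathcal{P} \in \Pi$ that maximizes $Q$ over $\Pi$ in time $\mathcal{O}(n)$ plus $\mathcal{O}(n)$ evaluations of the function $q$.
   Context: $G=(V,E)$ is an undirected graph with $n=|V|$ vertices. A dendrogram on $V$ is a rooted tree whose nodes are subsets of $V$: the root is $V$, the leaves are the $n$ singletons $\{v\}$, $v\in V$, and the children $\mathcal{C}_1,\dots,\mathcal{C}_k$ of any internal node $\mathcal{C}$ are pairwise disjoint with $\mathcal{C} = \mathcal{C}_1\cup\dots\cup\mathcal{C}_k$; it has $c<n$ internal nodes, so it has at most $2n$ nodes. $S$ denotes the set of all node sets of the dendrogram, and $\Pi$ is the set of all partitions of $V$ all of whose parts belong to $S$. A quality function assigns a real number to each partition; it is additive if there is a function $q$ on subsets of $V$ (the elementary function) with $Q(\mathcal{P}) = \sum_{\mathcal{C}\in\mathcal{P}} q(\mathcal{C})$ for every partition $\mathcal{P}$. *)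

theory Defs
  imports Complex_Main "HOL-Library.Disjoint_Sets" "HOL-Library.Landau_Symbols"
begin

section \<open>Dendrograms and additive quality functions\<close>

definition rooted_tree :: "'a set \<Rightarrow> ('a \<times> 'a) set \<Rightarrow> 'a \<Rightarrow> bool" where
  "rooted_tree N E r \<longleftrightarrow>
     E \<subseteq> N \<times> N \<and> r \<in> N \<and>
     (\<forall>x. (x, r) \<notin> E) \<and>
     (\<forall>y\<in>N - {r}. \<exists>!x. (x, y) \<in> E) \<and>
     (\<forall>y\<in>N. (r, y) \<in> E\<^sup>*)"

text \<open>
  \<open>S\<close> is the set of nodes and \<open>E\<close> the set of (parent, child) pairs, so \<open>E `` {C}\<close> is the
  set of children of \<open>C\<close>. As nodes are sets, distinct nodes are distinct sets; hence
  an internal node has at least two children, the empty set is not a node, and \<open>V\<close> is nonempty.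
\<close>

definition dendrogram :: "'v set \<Rightarrow> 'v set set \<Rightarrow> ('v set \<times> 'v set) set \<Rightarrow> bool" where
  "dendrogram V S E \<longleftrightarrow>
     finite V \<and> S \<subseteq> Pow V \<and> rooted_tree S E V \<and>
     {C \<in> S. E `` {C} = {}} = {{v} | v. v \<in> V} \<and>
     (\<forall>C\<in>S. E `` {C} \<noteq> {} \<longrightarrow> disjoint (E `` {C}) \<and> \<Union>(E `` {C}) = C)"

definition dendrogram_partitions :: "'v set \<Rightarrow> 'v set set \<Rightarrow> 'v set set set" where
  "dendrogram_partitions V S = {P. partition_on V P \<and> P \<subseteq> S}"

definition additive_quality :: "'v set \<Rightarrow> ('v set set \<Rightarrow> real) \<Rightarrow> ('v set \<Rightarrow> real) \<Rightarrow> bool" where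
  "additive_quality V Q q \<longleftrightarrow> (\<forall>P. partition_on V P \<longrightarrow> Q P = (\<Sum>C\<in>P. q C))"

section \<open>Model of computation\<close>

text \<open>
  A unit-cost random access machine with natural-number and real storage cells, programmed in
  a structured language. Reals can be added, subtracted and compared; there is no
  conversion from reals to naturals and no multiplication, so that unit cost is not
  exploitable. A program can access the function \<open>q\<close> only by the command \<open>Query\<close>.
  A program mentions finitely many variables and arrays; arrays are unbounded.
\<close>

type_synonym name = string

datatype iexp =
    IConst nat
  | IVar name
  | IGet name iexp
  | IAdd iexp iexp
  | ISub iexp iexp

datatype rexp =
    RConst int
  | RVar name
  | RGet name iexp
  | RAdd rexp rexp
  | RSub rexp rexp

datatype bexp =
    ILess iexp iexp
  | RLess rexp rexp
  | BNot bexp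
  | BAnd bexp bexp

datatype com =
    Skip
  | IAssign name iexp
  | IPut name iexp iexp
  | RAssign name rexp
  | RPut name iexp rexp
  | Query name iexp
  | Seq com com
  | Cond bexp com com
  | Loop bexp com

record state =
  ivar :: "name \<Rightarrow> nat"
  iarr :: "name \<Rightarrow> nat \<Rightarrow> nat"
  rvar :: "name \<Rightarrow> real"
  rarr :: "name \<Rightarrow> nat \<Rightarrow> real"

primrec ival :: "state \<Rightarrow> iexp \<Rightarrow> nat" where
  "ival s (IConst k) = k"
| "ival s (IVar x) = ivar s x"
| "ival s (IGet a e) = iarr s a (ival s e)"
| "ival s (IAdd e f) = ival s e + ival s f"
| "ival s (ISub e f) = ival s e - ival s f"

primrec rval :: "state \<Rightarrow> rexp \<Rightarrow> real" where
  "rval s (RConst k) = of_int k"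
| "rval s (RVar x) = rvar s x"
| "rval s (RGet a e) = rarr s a (ival s e)"
| "rval s (RAdd e f) = rval s e + rval s f"
| "rval s (RSub e f) = rval s e - rval s f"

primrec bval :: "state \<Rightarrow> bexp \<Rightarrow> bool" where
  "bval s (ILess e f) = (ival s e < ival s f)"
| "bval s (RLess e f) = (rval s e < rval s f)"
| "bval s (BNot b) = (\<not> bval s b)"
| "bval s (BAnd b c) = (bval s b \<and> bval s c)"

text \<open>Evaluating an expression takes one time unit per constant, access and operation in it.\<close>

primrec icost :: "iexp \<Rightarrow> nat" where
  "icost (IConst k) = 1"
| "icost (IVar x) = 1"
| "icost (IGet a e) = 1 + icost e"
| "icost (IAdd e f) = 1 + icost e + icost f"
| "icost (ISub e f) = 1 + icost e + icost f"

primrec rcost :: "rexp \<Rightarrow> nat" where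
  "rcost (RConst k) = 1"
| "rcost (RVar x) = 1"
| "rcost (RGet a e) = 1 + icost e"
| "rcost (RAdd e f) = 1 + rcost e + rcost f"
| "rcost (RSub e f) = 1 + rcost e + rcost f"

primrec bcost :: "bexp \<Rightarrow> nat" where
  "bcost (ILess e f) = 1 + icost e + icost f"
| "bcost (RLess e f) = 1 + rcost e + rcost f"
| "bcost (BNot b) = 1 + bcost b"
| "bcost (BAnd b c) = 1 + bcost b + bcost c"

text \<open>
  \<open>exec f c s t k s'\<close>: with oracle \<open>f\<close>, the program \<open>c\<close> started in \<open>s\<close> terminates in \<open>s'\<close>
  after \<open>t\<close> time units and \<open>k\<close> oracle evaluations. The time of an evaluation accounts only
  for posing the query and storing the answer.
\<close>

inductive exec :: "(nat \<Rightarrow> real) \<Rightarrow> com \<Rightarrow> state \<Rightarrow> nat \<Rightarrow> nat \<Rightarrow> state \<Rightarrow> bool" for f where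
  Skip: "exec f Skip s 1 0 s"
| IAssign: "exec f (IAssign x e) s (1 + icost e) 0
    (s\<lparr>ivar := (ivar s)(x := ival s e)\<rparr>)"
| IPut: "exec f (IPut a d e) s (1 + icost d + icost e) 0
    (s\<lparr>iarr := (iarr s)(a := (iarr s a)(ival s d := ival s e))\<rparr>)"
| RAssign: "exec f (RAssign x e) s (1 + rcost e) 0
    (s\<lparr>rvar := (rvar s)(x := rval s e)\<rparr>)"
| RPut: "exec f (RPut a d e) s (1 + icost d + rcost e) 0
    (s\<lparr>rarr := (rarr s)(a := (rarr s a)(ival s d := rval s e))\<rparr>)"
| Query: "exec f (Query x e) s (1 + icost e) 1
    (s\<lparr>rvar := (rvar s)(x := f (ival s e))\<rparr>)"
| Seq: "exec f c s t k s' \<Longrightarrow> exec f d s' t' k' s'' \<Longrightarrow>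
    exec f (Seq c d) s (t + t') (k + k') s''"
| CondTrue: "bval s b \<Longrightarrow> exec f c s t k s' \<Longrightarrow>
    exec f (Cond b c d) s (1 + bcost b + t) k s'"
| CondFalse: "\<not> bval s b \<Longrightarrow> exec f d s t k s' \<Longrightarrow>
    exec f (Cond b c d) s (1 + bcost b + t) k s'"
| LoopFalse: "\<not> bval s b \<Longrightarrow> exec f (Loop b c) s (1 + bcost b) 0 s"
| LoopTrue: "bval s b \<Longrightarrow> exec f c s t k s' \<Longrightarrow> exec f (Loop b c) s' t' k' s'' \<Longrightarrow>
    exec f (Loop b c) s (1 + bcost b + t + t') (k + k') s''"

inductive_cases SkipE: "exec f Skip s t k s'"
inductive_cases IAssignE: "exec f (IAssign x e) s t k s'"
inductive_cases IPutE: "exec f (IPut a d e) s t k s'"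
inductive_cases RAssignE: "exec f (RAssign x r) s t k s'"
inductive_cases RPutE: "exec f (RPut a d r) s t k s'"
inductive_cases QueryE: "exec f (Query x e) s t k s'"
inductive_cases SeqE: "exec f (Seq c d) s t k s'"
inductive_cases CondE: "exec f (Cond b c d) s t k s'"
inductive_cases LoopE: "exec f (Loop b c) s t k s'"

lemma exec_deterministic:
  "exec f c s t k s' \<Longrightarrow> exec f c s u l s'' \<Longrightarrow> t = u \<and> k = l \<and> s' = s''"
proof (induction arbitrary: u l s'' rule: exec.induct)
  case (Skip s)
  then show ?case by (rule SkipE) simp
next
  case (IAssign x e s)
  then show ?case by (rule IAssignE) simp
next
  case (IPut a d e s)
  then show ?case by (rule IPutE) simp
next
  case (RAssign x e s)
  then show ?case by (rule RAssignE) simp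
next
  case (RPut a d e s)
  then show ?case by (rule RPutE) simp
next
  case (Query x e s)
  then show ?case by (rule QueryE) simp
next
  case (Seq c s t k s' d t' k' r)
  from Seq.prems show ?case by (rule SeqE) (auto dest!: Seq.IH)
next
  case (CondTrue s b c t k s' d)
  from CondTrue.prems show ?case by (rule CondE) (use CondTrue.hyps in \<open>auto dest: CondTrue.IH\<close>)
next
  case (CondFalse s b d t k s' c)
  from CondFalse.prems show ?case by (rule CondE) (use CondFalse.hyps in \<open>auto dest: CondFalse.IH\<close>)
next
  case (LoopFalse s b c)
  from LoopFalse.prems show ?case by (rule LoopE) (use LoopFalse.hyps in simp_all)
next
  case (LoopTrue s b c t k s' t' k' r)
  from LoopTrue.prems show ?case by (rule LoopE) (use LoopTrue.hyps in \<open>auto dest!: LoopTrue.IH\<close>)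
qed

section \<open>Input and output format\<close>

text \<open>
  Vertices and nodes are presented by arbitrary numberings \<open>vx\<close> of \<open>V\<close> and \<open>nd\<close> of \<open>S\<close>.
  The children of node number \<open>i\<close> are listed, in arbitrary order and without repetition,
  in the segment of the array \<open>child\<close> from position \<open>first i\<close> up to, but excluding, \<open>last i\<close>;
  each leaf stores the number of its vertex. The rest of the memory is unconstrained.
\<close>

definition encodes_dendrogram ::
    "state \<Rightarrow> (nat \<Rightarrow> 'v) \<Rightarrow> (nat \<Rightarrow> 'v set) \<Rightarrow> 'v set \<Rightarrow> 'v set set \<Rightarrow> ('v set \<times> 'v set) set \<Rightarrow> bool"
  where
  "encodes_dendrogram s vx nd V S E \<longleftrightarrow>
     bij_betw vx {..<card V} V \<and>
     bij_betw nd {..<card S} S \<and>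
     ivar s ''root'' < card S \<and> nd (ivar s ''root'') = V \<and>
     (\<forall>i<card S.
        (\<forall>j\<in>{iarr s ''first'' i..<iarr s ''last'' i}. iarr s ''child'' j < card S) \<and>
        bij_betw (\<lambda>j. nd (iarr s ''child'' j))
          {iarr s ''first'' i..<iarr s ''last'' i} (E `` {nd i}) \<and>
        (E `` {nd i} = {} \<longrightarrow>
           iarr s ''vertex'' i < card V \<and> nd i = {vx (iarr s ''vertex'' i)}))"

text \<open>
  The output is a membership array: two vertices are in the same part iff they have the
  same label.
\<close>

definition output_partition :: "state \<Rightarrow> (nat \<Rightarrow> 'v) \<Rightarrow> nat \<Rightarrow> 'v set set" where
  "output_partition s vx n =
     (\<lambda>l. vx ` {v. v < n \<and> iarr s ''label'' v = l}) ` (iarr s ''label'' ` {..<n})"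

end

theory Submission imports Defs begin

text \<open>
  A partition of a node \<open>C\<close> into nodes is either \<open>{C}\<close> or splits along the children of \<open>C\<close>, because
  the nodes form a laminar family. Hence the optimal value satisfies
  \<open>best C = max (q C) (\<Sum>D. best D)\<close>, \<open>D\<close> ranging over the children. Processing the nodes in reverse
  breadth-first order evaluates this recursion with one query per node; a forward pass then replaces
  \<open>V\<close> step by step by the children of parts that are better split, which keeps the sum of the optimal
  values of the parts constant. Every internal node has at least two children, so there are at
  most \<open>2 n\<close> nodes.
\<close>

section \<open>Optimal substructure\<close>

text \<open>The machine has loops but no recursion, node numbers come in arbitrary order without
  parent pointers, and neither \<open>n\<close> nor the number of nodes is part of the input. The
  breadth-first queue supplies all of this: an order in which parents precede children, the parents'
  positions and, as its final length, the number of nodes. Backwards, a node is met after all its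
  children, so its accumulated sum is complete; forwards, it is met after its parent, so an
  ancestor's decision is inherited by reading a single entry. The program never stores the evolving
  partition. It only hands down the label of the topmost kept node; the sequence of partitions
  exists in the proof alone, as a closed formula (\<open>front\<close>) in the final labels.\<close>

lemma partition_on_superset_part:
  assumes "partition_on C P" "C \<in> P"
  shows "P = {C}"
proof -
  have "X = C" if "X \<in> P" for X
  proof (rule ccontr)
    assume "X \<noteq> C"
    then have "X \<inter> C = {}"
      using assms that by (auto simp: partition_on_def disjoint_def)
    moreover have "X \<subseteq> C" "X \<noteq> {}"
      using assms(1) that by (auto simp: partition_on_def)
    ultimately show False
      by blast
  qed
  then show ?thesis
    using assms(2) by blast
qed

section \<open>The tree structure of a dendrogram: laminarity and the number of nodes\<close>

locale dendro =
  fixes V :: "'v set" and S :: "'v set set" and E :: "('v set \<times> 'v set) set"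
  assumes dendrogram: "dendrogram V S E"
begin

lemma finite_V: "finite V" and nodes_subset: "C \<in> S \<Longrightarrow> C \<subseteq> V"
  and root_node: "V \<in> S" and no_parent_root: "(C, V) \<notin> E"
  and edge_nodes: "(C, D) \<in> E \<Longrightarrow> C \<in> S \<and> D \<in> S"
  and reachable: "C \<in> S \<Longrightarrow> (V, C) \<in> E\<^sup>*"
  and ex1_parent: "C \<in> S \<Longrightarrow> C \<noteq> V \<Longrightarrow> \<exists>!B. (B, C) \<in> E"
  using dendrogram by (auto simp: dendrogram_def rooted_tree_def)

lemma parent_unique: "(B, C) \<in> E \<Longrightarrow> (B', C) \<in> E \<Longrightarrow> B = B'"
  using ex1_parent edge_nodes no_parent_root by metis

lemma leaves: "{C \<in> S. E `` {C} = {}} = (\<lambda>v. {v}) ` V"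
  using dendrogram by (auto simp: dendrogram_def)

lemma internal_node: "E `` {C} \<noteq> {} \<Longrightarrow> C \<in> S"
  using edge_nodes by auto

lemma children_disjoint: "E `` {C} \<noteq> {} \<Longrightarrow> disjoint (E `` {C})"
  and children_Union: "E `` {C} \<noteq> {} \<Longrightarrow> \<Union>(E `` {C}) = C"
  using dendrogram internal_node[of C] by (simp_all add: dendrogram_def)

lemma finite_nodes: "finite S"
  using finite_V nodes_subset by (meson PowI finite_Pow_iff finite_subset subsetI)

lemma children_nodes: "E `` {C} \<subseteq> S"
  using edge_nodes by blast

lemma finite_children: "finite (E `` {C})"
  using children_nodes finite_nodes finite_subset by blast

text \<open>The loop would use up the only parent of \<open>C\<close>, so no path from the root
  could enter \<open>C\<close>.\<close>

lemma no_self_loop: "(C, C) \<notin> E"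
proof
  assume loop: "(C, C) \<in> E"
  have "X \<noteq> C" if "(V, X) \<in> E\<^sup>*" for X
    using that
  proof (induction rule: rtrancl_induct)
    case base
    then show ?case using loop no_parent_root by blast
  next
    case (step Y X)
    then show ?case using loop parent_unique by blast
  qed
  then show False
    using reachable edge_nodes loop by blast
qed

lemma child_subset: "(C, D) \<in> E \<Longrightarrow> D \<subseteq> C"
  using children_Union by blast

lemma child_psubset: "(C, D) \<in> E \<Longrightarrow> D \<subset> C"
  using child_subset no_self_loop by blast

text \<open>The empty set has no proper subset to serve as a child, so it would be a leaf; but
  leaves are singletons.\<close>

lemma node_nonempty: "C \<in> S \<Longrightarrow> C \<noteq> {}"
proof
  assume "C \<in> S" "C = {}"
  moreover have "E `` {{}} = {}"
    using child_psubset by blast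
  ultimately show False
    using leaves by blast
qed

lemma descendant_subset: "(C, D) \<in> E\<^sup>* \<Longrightarrow> D \<subseteq> C"
  by (induction rule: rtrancl_induct) (use child_subset in blast)+

text \<open>Induction along the path from the root to \<open>D\<close>. On a step from a node to its
  child, only a \<open>C\<close> strictly below that node needs thought: it lies below the same
  child or below a sibling, which is disjoint from it. Comparability is expressed by paths and not
  by inclusion so that the first edge can be extracted.\<close>

lemma laminar:
  assumes "D \<in> S" "C \<in> S"
  shows "(C, D) \<in> E\<^sup>* \<or> (D, C) \<in> E\<^sup>* \<or> D \<inter> C = {}"
  using reachable[OF assms(1)]
proof (induction rule: rtrancl_induct)
  case base
  then show ?case using reachable assms by blast
next
  case (step D D')
  consider "(C, D) \<in> E\<^sup>*" | "D = C" | D'' where "(D, D'') \<in> E" "(D'', C) \<in> E\<^sup>*" | "D \<inter> C = {}"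
    using step.IH by (metis converse_rtranclE)
  then show ?case
  proof cases
    case 3
    show ?thesis
    proof (cases "D'' = D'")
      case False
      then have "D'' \<inter> D' = {}"
        using 3 step.hyps children_disjoint[of D] unfolding disjoint_def by blast
      then show ?thesis
        using descendant_subset[OF 3(2)] by blast
    qed (use 3 in blast)
  qed (use step.hyps child_subset in \<open>auto intro: rtrancl.intros\<close>)
qed

lemma psubset_in_child:
  assumes "C \<in> S" "D \<in> S" "D \<subset> C"
  obtains B where "(C, B) \<in> E" "D \<subseteq> B"
proof -
  have "(C, D) \<in> E\<^sup>*"
    using laminar[OF assms(2,1)] descendant_subset[of D C] node_nonempty assms by blast
  then obtain B where "(C, B) \<in> E" "(B, D) \<in> E\<^sup>*"
    using assms(3) by (metis converse_rtranclE psubset_eq)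
  then show ?thesis
    using descendant_subset that by blast
qed

text \<open>A single child would coincide with the union of the children, hence with
  \<open>C\<close> itself.\<close>

lemma two_children:
  assumes "E `` {C} \<noteq> {}"
  shows "2 \<le> card (E `` {C})"
proof (rule ccontr)
  assume "\<not> ?thesis"
  moreover have "card (E `` {C}) \<noteq> 0"
    using assms finite_children by auto
  ultimately have "card (E `` {C}) = 1"
    by linarith
  then obtain D where "E `` {C} = {D}"
    by (auto simp: card_1_singleton_iff)
  then show False
    using children_Union[of C] child_psubset[of C D] by auto
qed

text \<open>Count the edges twice: by lower ends there are \<open>card S - 1\<close>, by upper ends
  at least two per internal node. The remaining nodes are leaves, and these number
  \<open>card V\<close>.\<close>

lemma card_nodes_le: "card S \<le> 2 * card V"
proof -
  let ?I = "{C \<in> S. E `` {C} \<noteq> {}}" and ?L = "{C \<in> S. E `` {C} = {}}"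
  have nodes: "S - {V} = (\<Union>C\<in>?I. E `` {C})"
  proof (intro set_eqI iffI)
    fix D
    assume "D \<in> S - {V}"
    then obtain C where "(C, D) \<in> E"
      using ex1_parent[of D] by auto
    then show "D \<in> (\<Union>C\<in>?I. E `` {C})"
      using edge_nodes by auto
  qed (use edge_nodes no_parent_root in auto)
  have "card ?L = card V"
    by (simp add: leaves card_image)
  moreover have "card ?I + card ?L = card S"
    by (subst card_Un_disjoint[symmetric])
      (auto simp: finite_nodes intro!: arg_cong[where f = card])
  moreover have "card (S - {V}) = (\<Sum>C\<in>?I. card (E `` {C}))"
    unfolding nodes using finite_nodes finite_children parent_unique
    by (intro card_UN_disjoint) auto
  then have "(\<Sum>C\<in>?I. 2) \<le> card (S - {V})"
    using two_children by (simp only:) (intro sum_mono, simp)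
  then have "2 * card ?I \<le> card S - 1"
    using root_node finite_nodes by simp
  ultimately show ?thesis
    by linarith
qed

text \<open>Defined as an optimum over partitions and not by the recursion, so that
  \<open>best q V\<close> is by definition the value to be reached; the recursion is then
  derived.\<close>

definition best :: "('v set \<Rightarrow> real) \<Rightarrow> 'v set \<Rightarrow> real" where
  "best q C = Max (sum q ` dendrogram_partitions C S)"

lemma finite_dendrogram_partitions: "finite (dendrogram_partitions C S)"
  by (rule finite_subset[of _ "Pow S"]) (auto simp: dendrogram_partitions_def finite_nodes)

lemma singleton_dendrogram_partition: "C \<in> S \<Longrightarrow> {C} \<in> dendrogram_partitions C S"
  using node_nonempty by (auto simp: dendrogram_partitions_def partition_on_def disjoint_def)

lemma best_ge: "P \<in> dendrogram_partitions C S \<Longrightarrow> sum q P \<le> best q C"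
  unfolding best_def using finite_dendrogram_partitions by simp

lemma best_attained:
  assumes "C \<in> S"
  obtains P where "P \<in> dendrogram_partitions C S" "sum q P = best q C"
proof -
  have "best q C \<in> sum q ` dendrogram_partitions C S"
    unfolding best_def using finite_dendrogram_partitions singleton_dendrogram_partition[OF assms]
    by (intro Max_in) auto
  then show ?thesis
    using that by auto
qed

lemma best_leaf:
  assumes "C \<in> S" "E `` {C} = {}"
  shows "best q C = q C"
proof -
  obtain P where P: "P \<in> dendrogram_partitions C S" "sum q P = best q C"
    using best_attained assms by blast
  obtain v where v: "C = {v}"
    using assms leaves by blast
  have "\<Union>P = {v}" "{} \<notin> P"
    using P(1) by (auto simp: v dendrogram_partitions_def partition_on_def)
  then have "C \<in> P"
    unfolding v by (metis Sup_upper UnionE insertI1 subset_singletonD)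
  then have "P = {C}"
    using P partition_on_superset_part by (auto simp: dendrogram_partitions_def)
  then show ?thesis
    using P by simp
qed

text \<open>For the upper bound an optimal partition is grouped by children; for the lower bound
  optimal partitions of the children are united.\<close>

lemma best_internal:
  assumes C: "C \<in> S" and internal: "E `` {C} \<noteq> {}"
  shows "best q C = max (q C) (\<Sum>D\<in>E `` {C}. best q D)"
proof (rule antisym)
  obtain P where P: "P \<in> dendrogram_partitions C S" "sum q P = best q C"
    using best_attained C by blast
  show "best q C \<le> max (q C) (\<Sum>D\<in>E `` {C}. best q D)"
  proof (cases "C \<in> P")
    case True
    then have "P = {C}"
      using P partition_on_superset_part by (auto simp: dendrogram_partitions_def)
    then show ?thesis
      using P by simp
  next
    case False
    \<comment> \<open>The parts that fall into the child \<open>D\<close>; laminarity forces each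
      part other than \<open>C\<close> into some child.\<close>
    define R where "R D = {X \<in> P. X \<subseteq> D}" for D
    have P': "\<Union>P = C" "disjoint P" "{} \<notin> P" "P \<subseteq> S"
      using P by (auto simp: dendrogram_partitions_def partition_on_def)
    have covered: "\<exists>D\<in>E `` {C}. X \<subseteq> D" if "X \<in> P" for X
    proof -
      have "X \<in> S" "X \<subset> C"
        using P' that False by auto
      then obtain D where "(C, D) \<in> E" "X \<subseteq> D"
        using psubset_in_child[OF C] by metis
      then show ?thesis
        by blast
    qed
    have disj: "D \<inter> D' = {}" if "D \<in> E `` {C}" "D' \<in> E `` {C}" "D \<noteq> D'" for D D'
      using children_disjoint[OF internal] that unfolding disjoint_def by blast
    have R_dp: "R D \<in> dendrogram_partitions D S" if D: "D \<in> E `` {C}" for D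
    proof -
      have "x \<in> \<Union>(R D)" if x: "x \<in> D" for x
      proof -
        obtain X where X: "X \<in> P" "x \<in> X"
          using P' children_Union[OF internal] D x by blast
        then obtain D' where "D' \<in> E `` {C}" "X \<subseteq> D'"
          using covered by blast
        then have "X \<subseteq> D"
          using disj D x X by blast
        then show ?thesis
          using X R_def by blast
      qed
      then show ?thesis
        using P' by (auto simp: dendrogram_partitions_def partition_on_def disjoint_def R_def)
    qed
    have "P = (\<Union>D\<in>E `` {C}. R D)"
      using covered by (auto simp: R_def)
    \<comment> \<open>Only the empty set fits into two disjoint children, and it is not a
      part.\<close>
    moreover have "R D \<inter> R D' = {}" if "D \<in> E `` {C}" "D' \<in> E `` {C}" "D \<noteq> D'" for D D'
    proof -
      have "X = {}" if "X \<in> R D" "X \<in> R D'" for X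
        using disj[OF \<open>D \<in> _\<close> \<open>D' \<in> _\<close> \<open>D \<noteq> D'\<close>] that by (auto simp: R_def)
      then show ?thesis
        using P'(3) by (auto simp: R_def)
    qed
    moreover have "finite (R D)" for D
      by (rule finite_subset[of _ S]) (use P'(4) finite_nodes in \<open>auto simp: R_def\<close>)
    ultimately have "sum q P = (\<Sum>D\<in>E `` {C}. sum q (R D))"
      using finite_children by (simp add: sum.UNION_disjoint)
    also have "\<dots> \<le> (\<Sum>D\<in>E `` {C}. best q D)"
      using R_dp by (intro sum_mono best_ge)
    finally show ?thesis
      using P by simp
  qed
next
  have "\<forall>D\<in>E `` {C}. \<exists>P. P \<in> dendrogram_partitions D S \<and> sum q P = best q D"
    using best_attained children_nodes by blast
  then obtain R where R: "\<And>D. D \<in> E `` {C} \<Longrightarrow> R D \<in> dendrogram_partitions D S"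
    and R_best: "\<And>D. D \<in> E `` {C} \<Longrightarrow> sum q (R D) = best q D"
    by metis
  have part: "partition_on D (R D)" "R D \<subseteq> S" if "D \<in> E `` {C}" for D
    using R[OF that] by (auto simp: dendrogram_partitions_def)
  have disj: "X \<inter> Y = {}"
    if "D \<in> E `` {C}" "D' \<in> E `` {C}" "D \<noteq> D'" "X \<in> R D" "Y \<in> R D'" for D D' X Y
  proof -
    have "X \<subseteq> D" "Y \<subseteq> D'"
      using part that by (auto simp: partition_on_def)
    then show ?thesis
      using children_disjoint[OF internal] that unfolding disjoint_def by blast
  qed
  have "(\<Union>D\<in>E `` {C}. R D) \<in> dendrogram_partitions C S"
  proof -
    have "\<Union>(\<Union>D\<in>E `` {C}. R D) = (\<Union>D\<in>E `` {C}. \<Union>(R D))"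
      by blast
    also have "\<dots> = \<Union>(E `` {C})"
      using part(1) by (auto simp: partition_on_def)
    also have "\<dots> = C"
      using children_Union internal by blast
    finally have "\<Union>(\<Union>D\<in>E `` {C}. R D) = C" .
    moreover have "disjoint (\<Union>D\<in>E `` {C}. R D)"
    proof (rule disjointI)
      fix X Y
      assume "X \<in> (\<Union>D\<in>E `` {C}. R D)" "Y \<in> (\<Union>D\<in>E `` {C}. R D)" "X \<noteq> Y"
      then obtain D D' where D: "D \<in> E `` {C}" "D' \<in> E `` {C}" "X \<in> R D" "Y \<in> R D'"
        by blast
      show "X \<inter> Y = {}"
      proof (cases "D = D'")
        case True
        then show ?thesis
          using part(1) D \<open>X \<noteq> Y\<close> by (auto simp: partition_on_def disjoint_def)
      qed (use D disj in blast)
    qed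
    ultimately show ?thesis
      using part by (simp add: dendrogram_partitions_def partition_on_def) blast
  qed
  then have "sum q (\<Union>D\<in>E `` {C}. R D) \<le> best q C"
    by (rule best_ge)
  moreover have "sum q (\<Union>D\<in>E `` {C}. R D) = (\<Sum>D\<in>E `` {C}. sum q (R D))"
  proof (rule sum.UNION_disjoint)
    show "\<forall>D\<in>E `` {C}. finite (R D)"
      using part(2) finite_nodes finite_subset by blast
    \<comment> \<open>Nonempty parts keep the families apart: a set common to two of them would be
      disjoint from itself.\<close>
    have "X \<noteq> {}" if "D \<in> E `` {C}" "X \<in> R D" for D X
      using part(1)[OF that(1)] that(2) by (auto simp: partition_on_def)
    then show "\<forall>D\<in>E `` {C}. \<forall>D'\<in>E `` {C}. D \<noteq> D' \<longrightarrow> R D \<inter> R D' = {}"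
      using disj by (metis Int_absorb disjoint_iff)
  qed (rule finite_children)
  moreover have "\<dots> = (\<Sum>D\<in>E `` {C}. best q D)"
    using R_best by (rule sum.cong[OF refl])
  moreover have "q C \<le> best q C"
    using best_ge[OF singleton_dendrogram_partition[OF C], of q] by simp
  ultimately show "max (q C) (\<Sum>D\<in>E `` {C}. best q D) \<le> best q C"
    by simp
qed

end

section \<open>Labels in breadth-first order\<close>

lemma partition_on_refine_part:
  assumes "partition_on V P" "C \<in> P" "partition_on C R"
  shows "partition_on V (P - {C} \<union> R)"
proof (rule partition_onI)
  have parts: "\<Union>P = V" "disjoint P" "{} \<notin> P" "\<Union>R = C" "disjoint R" "{} \<notin> R"
    using assms by (auto simp: partition_on_def)
  show "\<Union>(P - {C} \<union> R) = V"
    using parts assms(2) by auto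
  show "{} \<notin> P - {C} \<union> R"
    using parts by auto
  have other: "X \<inter> Y = {}" if "X \<in> P - {C}" "Y \<in> R" for X Y
  proof -
    have "X \<inter> C = {}" "Y \<subseteq> C"
      using that parts assms(2) by (auto simp: disjoint_def)
    then show ?thesis
      by blast
  qed
  show "disjnt X Y" if XY: "X \<in> P - {C} \<union> R" "Y \<in> P - {C} \<union> R" "X \<noteq> Y" for X Y
  proof -
    consider "X \<in> P" "Y \<in> P" | "X \<in> R" "Y \<in> R" | "X \<in> P - {C}" "Y \<in> R" | "X \<in> R" "Y \<in> P - {C}"
      using XY by blast
    then show ?thesis
      using parts(2,5) XY(3) other[of X Y] other[of Y X]
      by cases (auto simp: disjnt_def disjoint_def)
  qed
qed

section \<open>Nodes addressed by positions that increase from parent to child\<close>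

locale ordered_dendro = dendro V S E
  for V :: "'v set" and S E +
  fixes N :: "nat \<Rightarrow> 'v set" and par :: "nat \<Rightarrow> nat"
  assumes N_bij: "bij_betw N {..<card S} S"
    and N_root: "N 0 = V"
    and par_less: "0 < p \<Longrightarrow> p < card S \<Longrightarrow> par p < p"
    and N_children: "p < card S \<Longrightarrow> E `` {N p} = N ` {c. 0 < c \<and> c < card S \<and> par c = p}"
begin

text \<open>Position 0 is excluded because the program stores 0 as the parent of the root, which
  must not become its own child.\<close>

definition ch :: "nat \<Rightarrow> nat set" where
  "ch p = {c. 0 < c \<and> c < card S \<and> par c = p}"

text \<open>\<open>Suc p\<close> leaves 0 free as the mark for splitting, even at the root position
  0. The test on \<open>ch p\<close> protects leaves: a negative value of \<open>q\<close> would lie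
  below the empty sum. Ties favour the undivided node.\<close>

definition cut :: "('v set \<Rightarrow> real) \<Rightarrow> nat \<Rightarrow> nat" where
  "cut q p = (if ch p \<noteq> {} \<and> q (N p) < (\<Sum>c\<in>ch p. best q (N c)) then 0 else Suc p)"

lemma finite_ch: "finite (ch p)"
  by (simp add: ch_def)

lemma N_node: "p < card S \<Longrightarrow> N p \<in> S"
  using N_bij by (auto simp: bij_betw_def)

lemma N_eq_iff: "p < card S \<Longrightarrow> p' < card S \<Longrightarrow> N p = N p' \<longleftrightarrow> p = p'"
  using N_bij by (auto simp: bij_betw_def inj_on_def)

lemma N_ch: "p < card S \<Longrightarrow> E `` {N p} = N ` ch p"
  using N_children by (simp add: ch_def)

lemma inj_on_ch: "inj_on N (ch p)"
  by (auto simp: inj_on_def ch_def N_eq_iff)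

lemma best_position:
  assumes "p < card S"
  shows "best q (N p) = (if cut q p = 0 then \<Sum>c\<in>ch p. best q (N c) else q (N p))"
proof (cases "ch p = {}")
  case True
  then show ?thesis
    using best_leaf[of "N p" q] N_node N_ch assms by (simp add: cut_def)
next
  case False
  then have "best q (N p) = max (q (N p)) (\<Sum>D\<in>N ` ch p. best q D)"
    using best_internal[of "N p" q] N_node N_ch assms by simp
  also have "(\<Sum>D\<in>N ` ch p. best q D) = (\<Sum>c\<in>ch p. best q (N c))"
    by (simp add: sum.reindex inj_on_ch)
  finally show ?thesis
    using False by (auto simp: cut_def)
qed

lemma card_nodes_pos: "0 < card S"
  using root_node finite_nodes card_gt_0_iff by blast

end

section \<open>Inherited labels and the partition they select\<close>

locale labelled_dendro = ordered_dendro V S E N par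
  for V :: "'v set" and S E N par +
  fixes q :: "'v set \<Rightarrow> real" and lab :: "nat \<Rightarrow> nat"
  assumes lab: "p < card S \<Longrightarrow> lab p = (if 0 < p \<and> 0 < lab (par p) then lab (par p) else cut q p)"
begin

text \<open>The topmost kept positions: an inherited label is never \<open>Suc p\<close>, so no
  ancestor of such a position is kept.\<close>

definition selected :: "nat set" where
  "selected = {p. p < card S \<and> lab p = Suc p}"

lemma cut_cases: "cut q p = 0 \<or> cut q p = Suc p"
  by (simp add: cut_def)

lemma lab_le: "p < card S \<Longrightarrow> lab p \<le> Suc p"
proof (induction p rule: less_induct)
  case (less p)
  show ?case
    using lab[OF less.prems] cut_cases[of p] par_less[of p] less.IH[of "par p"] less.prems
    by (auto split: if_splits)
qed

text \<open>The label comes from the parent, so it is at most \<open>Suc (par p)\<close>, and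
  \<open>par p < p\<close>. This tells inherited labels from own ones.\<close>

lemma lab_inherited_le: "p < card S \<Longrightarrow> 0 < p \<Longrightarrow> 0 < lab (par p) \<Longrightarrow> lab p \<le> p"
  using lab[of p] lab_le[of "par p"] par_less[of p] by auto

text \<open>A label travels down unchanged from the position that created it, and every edge on the
  way is an inclusion.\<close>

lemma lab_selected:
  assumes "p < card S" "0 < lab p"
  shows "lab p - 1 \<in> selected \<and> N p \<subseteq> N (lab p - 1)"
  using assms
proof (induction p rule: less_induct)
  case (less p)
  show ?case
  proof (cases "0 < p \<and> 0 < lab (par p)")
    case True
    then have "lab (par p) - 1 \<in> selected \<and> N (par p) \<subseteq> N (lab (par p) - 1)"
      using less.IH[of "par p"] par_less[of p] less.prems by simp
    moreover have "(N (par p), N p) \<in> E"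
      using N_children[of "par p"] par_less[of p] True less.prems by auto
    ultimately show ?thesis
      using child_subset lab[OF less.prems(1)] True by auto
  next
    case False
    then show ?thesis
      using lab[OF less.prems(1)] cut_cases[of p] less.prems by (auto simp: selected_def)
  qed
qed

text \<open>The partition once the positions below \<open>h\<close> have been treated: settled
  positions that were kept, together with waiting positions whose parent was split. The root waits
  from the start, without a parent.\<close>

definition front :: "nat \<Rightarrow> nat set" where
  "front h = {p. p < card S \<and> (if p < h then lab p = Suc p
     else p = 0 \<or> (par p < h \<and> lab (par p) = 0))}"

lemma front_Suc:
  assumes "h < card S"
  shows "front (Suc h) = (if h \<in> front h \<and> cut q h = 0 then front h - {h} \<union> ch h else front h)"
proof -
  \<comment> \<open>A waiting \<open>h\<close> is the root or has a parent labelled 0, so its label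
    is its own \<open>cut\<close> value. Any other \<open>h\<close> inherits a nonzero label, which
    cannot be \<open>Suc h\<close>.\<close>
  consider "h \<in> front h" "cut q h = 0" "lab h = 0"
    | "h \<in> front h" "cut q h \<noteq> 0" "lab h = Suc h"
    | "h \<notin> front h" "0 < lab h" "lab h \<noteq> Suc h"
    using lab[OF assms] lab_inherited_le[OF assms] par_less[of h] assms cut_cases[of h]
    by (fastforce simp: front_def split: if_splits)
  then show ?thesis
  proof cases
    case 1
    have "p \<in> front (Suc h) \<longleftrightarrow> p \<in> front h - {h} \<union> ch h" for p
      using 1 assms par_less[of p] by (auto simp: front_def ch_def less_Suc_eq)
    with 1 show ?thesis
      by auto
  next
    case 2
    have "p \<in> front (Suc h) \<longleftrightarrow> p \<in> front h" for p
      using 2 assms par_less[of p] by (auto simp: front_def ch_def less_Suc_eq)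
    with 2 show ?thesis
      by auto
  next
    case 3
    have "p \<in> front (Suc h) \<longleftrightarrow> p \<in> front h" for p
      using 3 assms par_less[of p] by (auto simp: front_def ch_def less_Suc_eq)
    with 3 show ?thesis
      by auto
  qed
qed

lemma front_bounded: "p \<in> front h \<Longrightarrow> p < card S"
  by (simp add: front_def)

lemma partition_front:
  assumes "h \<le> card S"
  shows "partition_on V (N ` front h) \<and> (\<Sum>p\<in>front h. best q (N p)) = best q V"
  using assms
proof (induction h)
  case 0
  have "front 0 = {0}"
    using card_nodes_pos by (auto simp: front_def)
  then show ?case
    using node_nonempty root_node by (simp add: N_root partition_on_space)
next
  case (Suc h)
  show ?case
  proof (cases "h \<in> front h \<and> cut q h = 0")
    case True
    have h: "h < card S"
      using Suc.prems by simp
    have internal: "E `` {N h} \<noteq> {}"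
      using True N_ch[OF h] by (auto simp: cut_def split: if_splits)
    have front: "front (Suc h) = front h - {h} \<union> ch h"
      using front_Suc[OF h] True by simp
    have "partition_on (N h) (N ` ch h)"
      unfolding N_ch[OF h, symmetric]
      using children_Union[OF internal] children_disjoint[OF internal] children_nodes[of "N h"] node_nonempty
      by (auto simp: partition_on_def)
    moreover have "N ` (front h - {h}) = N ` front h - {N h}"
      using front_bounded N_eq_iff h by auto
    then have "N ` front (Suc h) = N ` front h - {N h} \<union> N ` ch h"
      by (simp add: front image_Un)
    ultimately have "partition_on V (N ` front (Suc h))"
      using partition_on_refine_part[of V "N ` front h" "N h" "N ` ch h"] Suc True by simp
    moreover have "(\<Sum>p\<in>front (Suc h). best q (N p)) = (\<Sum>p\<in>front h. best q (N p))"
    proof -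
      have fin: "finite (front h)"
        by (simp add: front_def)
      \<comment> \<open>Children come later than \<open>h\<close>, and their parent \<open>h\<close>
        is not yet settled.\<close>
      have "c \<notin> front h" if "c \<in> ch h" for c
        using that par_less[of c] by (auto simp: front_def ch_def)
      then have "(front h - {h}) \<inter> ch h = {}"
        by blast
      then have "(\<Sum>p\<in>front (Suc h). best q (N p)) =
          (\<Sum>p\<in>front h - {h}. best q (N p)) + (\<Sum>p\<in>ch h. best q (N p))"
        unfolding front using fin finite_ch by (simp add: sum.union_disjoint)
      also have "\<dots> = (\<Sum>p\<in>front h - {h}. best q (N p)) + best q (N h)"
        using best_position[OF h, of q] True by simp
      also have "\<dots> = (\<Sum>p\<in>front h. best q (N p))"
        using True fin sum.remove[of "front h" h "\<lambda>p. best q (N p)"] by simp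
      finally show ?thesis .
    qed
    ultimately show ?thesis
      using Suc by simp
  next
    case False
    then have "front (Suc h) = front h"
      using front_Suc[of h] Suc.prems by auto
    then show ?thesis
      using Suc by simp
  qed
qed

lemma front_card: "front (card S) = selected"
  by (auto simp: front_def selected_def)

lemma selected_partition: "N ` selected \<in> dendrogram_partitions V S"
  using partition_front[of "card S"] N_node
  by (auto simp: front_card dendrogram_partitions_def selected_def)

text \<open>A selected position bears its own label, so its \<open>cut\<close> value is nonzero and
  \<open>q\<close> attains \<open>best\<close> there. What remains is the constant sum over the last
  front.\<close>

lemma sum_selected: "sum q (N ` selected) = best q V"
proof -
  have "sum q (N ` selected) = (\<Sum>p\<in>selected. q (N p))"
    by (rule sum.reindex_cong[of N]) (auto simp: inj_on_def selected_def N_eq_iff)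
  also have "\<dots> = (\<Sum>p\<in>selected. best q (N p))"
  proof (rule sum.cong[OF refl])
    fix p
    assume p: "p \<in> selected"
    then have "cut q p \<noteq> 0"
      using lab[of p] lab_inherited_le[of p] by (auto simp: selected_def split: if_splits)
    then show "q (N p) = best q (N p)"
      using best_position[of p q] p by (simp add: selected_def)
  qed
  also have "\<dots> = best q V"
    using partition_front[of "card S"] by (simp add: front_card)
  finally show ?thesis .
qed

lemma selected_arg_max:
  assumes "additive_quality V Q q"
  shows "is_arg_max Q (\<lambda>P. P \<in> dendrogram_partitions V S) (N ` selected)"
proof -
  have Q: "Q P = sum q P" if "P \<in> dendrogram_partitions V S" for P
    using assms that by (simp add: additive_quality_def dendrogram_partitions_def)
  show ?thesis
    using selected_partition best_ge[of _ V q]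
    by (auto simp: is_arg_max_def Q sum_selected not_less)
qed

text \<open>Every vertex is a leaf, and the label of a leaf names a selected node containing it.
  Selected nodes are disjoint, so the level sets of the label array are exactly these nodes.\<close>

lemma output_selected:
  assumes vx: "bij_betw vx {..<card V} V"
    and leaf: "\<And>p. p < card S \<Longrightarrow> ch p = {} \<Longrightarrow>
      vert p < card V \<and> N p = {vx (vert p)} \<and> iarr s ''label'' (vert p) = lab p"
  shows "output_partition s vx (card V) = N ` selected"
proof -
  let ?l = "iarr s ''label''" and ?n = "card V"
  have label: "\<exists>r\<in>selected. ?l v = Suc r \<and> vx v \<in> N r" if v: "v < ?n" for v
  proof -
    have "vx v \<in> V"
      using vx v by (auto simp: bij_betw_def)
    then have "{vx v} \<in> S" "E `` {{vx v}} = {}"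
      using leaves by auto
    then obtain p where p: "p < card S" "N p = {vx v}"
      using N_bij unfolding bij_betw_def by (metis imageE lessThan_iff)
    then have "ch p = {}"
      using N_ch[of p] \<open>E `` {{vx v}} = {}\<close> by simp
    then have "vx (vert p) = vx v" "vert p < ?n" "?l (vert p) = lab p"
      using leaf[of p] p by auto
    then have "?l v = lab p"
      using vx v by (auto simp: bij_betw_def inj_on_def)
    \<comment> \<open>\<open>cut\<close> is never 0 at a leaf, so every vertex receives the label of
      some part.\<close>
    moreover have "0 < lab p"
      using lab[of p] p \<open>ch p = {}\<close> by (auto simp: cut_def)
    ultimately show ?thesis
      using lab_selected[of p] p by (intro bexI[of _ "lab p - 1"]) auto
  qed
  have disj: "r = r'" if "r \<in> selected" "r' \<in> selected" "x \<in> N r" "x \<in> N r'" for r r' x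
  proof -
    have "disjoint (N ` selected)"
      using selected_partition by (simp add: dendrogram_partitions_def partition_on_def)
    then have "N r = N r'"
      using that unfolding disjoint_def by blast
    then show ?thesis
      using that N_eq_iff by (auto simp: selected_def)
  qed
  have part: "vx ` {v. v < ?n \<and> ?l v = Suc r} = N r" if r: "r \<in> selected" for r
  proof (intro set_eqI iffI)
    fix x
    assume x: "x \<in> N r"
    then have "x \<in> V"
      using nodes_subset[OF N_node[of r]] r by (auto simp: selected_def)
    then obtain v where v: "v < ?n" "x = vx v"
      using vx by (auto simp: bij_betw_def)
    then show "x \<in> vx ` {v. v < ?n \<and> ?l v = Suc r}"
      using label[OF v(1)] disj x r by blast
  qed (use label in fastforce)
  have "?l ` {..<?n} = Suc ` selected"
  proof (intro set_eqI iffI)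
    fix l
    assume "l \<in> Suc ` selected"
    then obtain r where r: "r \<in> selected" "l = Suc r"
      by blast
    then have "N r \<noteq> {}"
      using node_nonempty N_node by (simp add: selected_def)
    then obtain v where "v < ?n" "?l v = l"
      using part[OF r(1)] r(2) by force
    then show "l \<in> ?l ` {..<?n}"
      by blast
  qed (use label in fastforce)
  then show ?thesis
    by (auto simp: output_partition_def part image_image)
qed

end

section \<open>Programs with a time budget\<close>

text \<open>\<open>x\<close> is a time budget; the postcondition also receives what is left of it.\<close>

definition wp :: "(nat \<Rightarrow> real) \<Rightarrow> com \<Rightarrow> (state \<Rightarrow> nat \<Rightarrow> bool) \<Rightarrow> state \<Rightarrow> nat \<Rightarrow> bool" where
  "wp f c Q s x \<longleftrightarrow> (\<exists>t k s'. exec f c s t k s' \<and> t \<le> x \<and> Q s' (x - t))"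

lemma wpI: "exec f c s t k s' \<Longrightarrow> t \<le> x \<Longrightarrow> Q s' (x - t) \<Longrightarrow> wp f c Q s x"
  unfolding wp_def by blast

text \<open>Determinism identifies the run asserted by \<open>wp\<close> with the given one. The
  resulting equivalences serve as rewrite rules.\<close>

lemma wp_exec: "exec f c s t k s' \<Longrightarrow> wp f c Q s x \<longleftrightarrow> t \<le> x \<and> Q s' (x - t)"
  unfolding wp_def using exec_deterministic by blast

lemma wp_IAssign:
  "wp f (IAssign y e) Q s x \<longleftrightarrow>
     1 + icost e \<le> x \<and> Q (s\<lparr>ivar := (ivar s)(y := ival s e)\<rparr>) (x - (1 + icost e))"
  by (rule wp_exec) (rule exec.IAssign)

lemma wp_IPut:
  "wp f (IPut a d e) Q s x \<longleftrightarrow>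
     1 + icost d + icost e \<le> x \<and>
     Q (s\<lparr>iarr := (iarr s)(a := (iarr s a)(ival s d := ival s e))\<rparr>) (x - (1 + icost d + icost e))"
  by (rule wp_exec) (rule exec.IPut)

lemma wp_RAssign:
  "wp f (RAssign y e) Q s x \<longleftrightarrow>
     1 + rcost e \<le> x \<and> Q (s\<lparr>rvar := (rvar s)(y := rval s e)\<rparr>) (x - (1 + rcost e))"
  by (rule wp_exec) (rule exec.RAssign)

lemma wp_RPut:
  "wp f (RPut a d e) Q s x \<longleftrightarrow>
     1 + icost d + rcost e \<le> x \<and>
     Q (s\<lparr>rarr := (rarr s)(a := (rarr s a)(ival s d := rval s e))\<rparr>) (x - (1 + icost d + rcost e))"
  by (rule wp_exec) (rule exec.RPut)

lemma wp_Query: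
  "wp f (Query y e) Q s x \<longleftrightarrow>
     1 + icost e \<le> x \<and> Q (s\<lparr>rvar := (rvar s)(y := f (ival s e))\<rparr>) (x - (1 + icost e))"
  by (rule wp_exec) (rule exec.Query)

lemma wp_Skip: "wp f Skip Q s x \<longleftrightarrow> 1 \<le> x \<and> Q s (x - 1)"
  by (rule wp_exec) (rule exec.Skip)

lemma wp_Seq: "wp f (Seq c d) Q s x \<longleftrightarrow> wp f c (wp f d Q) s x"
proof
  assume "wp f (Seq c d) Q s x"
  then obtain t k s' where "exec f (Seq c d) s t k s'" "t \<le> x" "Q s' (x - t)"
    by (auto simp: wp_def)
  then show "wp f c (wp f d Q) s x"
    by (elim SeqE) (fastforce simp: wp_def)
next
  assume "wp f c (wp f d Q) s x"
  then obtain t k s' u l s'' where "exec f c s t k s'" "t \<le> x"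
    "exec f d s' u l s''" "u \<le> x - t" "Q s'' (x - t - u)"
    by (auto simp: wp_def)
  then show "wp f (Seq c d) Q s x"
    by (intro wpI[OF exec.Seq]) auto
qed

lemma wp_Cond:
  "wp f (Cond b c d) Q s x \<longleftrightarrow>
     1 + bcost b \<le> x \<and> wp f (if bval s b then c else d) Q s (x - (1 + bcost b))"
proof
  assume "wp f (Cond b c d) Q s x"
  then obtain t k s' where "exec f (Cond b c d) s t k s'" "t \<le> x" "Q s' (x - t)"
    by (auto simp: wp_def)
  then show "1 + bcost b \<le> x \<and> wp f (if bval s b then c else d) Q s (x - (1 + bcost b))"
    by (elim CondE) (fastforce simp: wp_def)+
next
  assume *: "1 + bcost b \<le> x \<and> wp f (if bval s b then c else d) Q s (x - (1 + bcost b))"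
  then obtain t k s' where c: "exec f (if bval s b then c else d) s t k s'"
    "t \<le> x - (1 + bcost b)" "Q s' (x - (1 + bcost b) - t)"
    by (auto simp: wp_def)
  have "exec f (Cond b c d) s (1 + bcost b + t) k s'"
    using c(1) exec.CondTrue exec.CondFalse by (metis (full_types))
  with * c show "wp f (Cond b c d) Q s x"
    by (intro wpI) auto
qed

lemmas wp_simps = wp_IAssign wp_IPut wp_RAssign wp_RPut wp_Query wp_Skip wp_Seq wp_Cond

lemma wp_mono: "wp f c Q s x \<Longrightarrow> (\<And>s x. Q s x \<Longrightarrow> R s x) \<Longrightarrow> wp f c R s x"
  unfolding wp_def by blast

text \<open>Every iteration consumes time, so the budget itself is a termination measure.\<close>

lemma wp_Loop:
  assumes "I s x"
    and "\<And>s x. I s x \<Longrightarrow> 1 + bcost b \<le> x"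
    and "\<And>s x. I s x \<Longrightarrow> bval s b \<Longrightarrow> wp f c I s (x - (1 + bcost b))"
    and "\<And>s x. I s x \<Longrightarrow> \<not> bval s b \<Longrightarrow> Q s (x - (1 + bcost b))"
  shows "wp f (Loop b c) Q s x"
  using assms(1)
proof (induction x arbitrary: s rule: less_induct)
  case (less x)
  show ?case
  proof (cases "bval s b")
    case True
    then obtain t k s' where c: "exec f c s t k s'" "t \<le> x - (1 + bcost b)" "I s' (x - (1 + bcost b) - t)"
      using assms(3)[OF less.prems] unfolding wp_def by blast
    have budget: "1 + bcost b \<le> x"
      using assms(2) less.prems .
    then have "wp f (Loop b c) Q s' (x - (1 + bcost b) - t)"
      using less.IH c(3) by simp
    then obtain u l s'' where "exec f (Loop b c) s' u l s''" "u \<le> x - (1 + bcost b) - t"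
      "Q s'' (x - (1 + bcost b) - t - u)"
      by (auto simp: wp_def)
    then show ?thesis
      using c budget by (intro wpI[OF exec.LoopTrue[OF True c(1)]]) auto
  next
    case False
    then show ?thesis
      using less.prems assms(2,4) by (intro wpI[OF exec.LoopFalse])
  qed
qed

text \<open>Posing a query costs time, so one linear bound serves for time and queries, and
  \<open>wp\<close> need not count the latter.\<close>

lemma queries_le_time: "exec f c s t k s' \<Longrightarrow> k \<le> t"
  by (induction rule: exec.induct) auto

section \<open>The linear-time program\<close>

notation Seq (infixr \<open>;;\<close> 60)

text \<open>
  Nodes are addressed by their position in breadth-first order: \<open>ord\<close> maps a position to its node
  number and \<open>par\<close> to the position of the parent, so that \<open>par p < p\<close> except at the root, where
  \<open>par 0 = 0\<close>. The entry \<open>cut p\<close> is \<open>p + 1\<close> if keeping the node in one piece is optimal for it and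
  \<open>0\<close> otherwise; \<open>descend\<close> overwrites it by the nonzero entry of the topmost such ancestor, if any.
\<close>

definition append_children :: com where
  "append_children =
    Loop (ILess (IVar ''j'') (IGet ''last'' (IGet ''ord'' (IVar ''head''))))
     (IPut ''ord'' (IVar ''tail'') (IGet ''child'' (IVar ''j'')) ;;
      IPut ''par'' (IVar ''tail'') (IVar ''head'') ;;
      RPut ''acc'' (IVar ''tail'') (RConst 0) ;;
      IAssign ''tail'' (IAdd (IVar ''tail'') (IConst 1)) ;;
      IAssign ''j'' (IAdd (IVar ''j'') (IConst 1)))"

text \<open>Memory is arbitrary at the start and the number of nodes unknown, so each
  \<open>acc\<close> entry is cleared when its position enters the queue.\<close>

definition search :: com where
  "search =
    IPut ''ord'' (IConst 0) (IVar ''root'') ;;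
    IPut ''par'' (IConst 0) (IConst 0) ;;
    RPut ''acc'' (IConst 0) (RConst 0) ;;
    IAssign ''head'' (IConst 0) ;;
    IAssign ''tail'' (IConst 1) ;;
    Loop (ILess (IVar ''head'') (IVar ''tail''))
     (IAssign ''j'' (IGet ''first'' (IGet ''ord'' (IVar ''head''))) ;;
      append_children ;;
      IAssign ''head'' (IAdd (IVar ''head'') (IConst 1)))"

text \<open>At the root, \<open>par 0 = 0\<close> directs the final update to the root's own
  accumulator, which has then been read for the last time.\<close>

definition ascend :: com where
  "ascend =
    Loop (ILess (IConst 0) (IVar ''head''))
     (IAssign ''head'' (ISub (IVar ''head'') (IConst 1)) ;;
      Query ''x'' (IGet ''ord'' (IVar ''head'')) ;;
      Cond (BAnd (ILess (IGet ''first'' (IGet ''ord'' (IVar ''head'')))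
                        (IGet ''last'' (IGet ''ord'' (IVar ''head''))))
                 (RLess (RVar ''x'') (RGet ''acc'' (IVar ''head''))))
       (IPut ''cut'' (IVar ''head'') (IConst 0) ;;
        RAssign ''x'' (RGet ''acc'' (IVar ''head'')))
       (IPut ''cut'' (IVar ''head'') (IAdd (IVar ''head'') (IConst 1))) ;;
      RPut ''acc'' (IGet ''par'' (IVar ''head''))
        (RAdd (RGet ''acc'' (IGet ''par'' (IVar ''head''))) (RVar ''x'')))"

text \<open>The root needs no special case: with \<open>par 0 = 0\<close> its entry is at most
  copied onto itself.\<close>

definition descend :: com where
  "descend =
    IAssign ''head'' (IConst 0) ;;
    Loop (ILess (IVar ''head'') (IVar ''tail''))
     (Cond (ILess (IConst 0) (IGet ''cut'' (IGet ''par'' (IVar ''head''))))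
       (IPut ''cut'' (IVar ''head'') (IGet ''cut'' (IGet ''par'' (IVar ''head''))))
       Skip ;;
      Cond (ILess (IGet ''first'' (IGet ''ord'' (IVar ''head'')))
                  (IGet ''last'' (IGet ''ord'' (IVar ''head''))))
       Skip
       (IPut ''label'' (IGet ''vertex'' (IGet ''ord'' (IVar ''head'')))
         (IGet ''cut'' (IVar ''head''))) ;;
      IAssign ''head'' (IAdd (IVar ''head'') (IConst 1)))"

definition optimise :: com where
  "optimise = search ;; ascend ;; descend"

section \<open>Breadth-first search: the queue invariant and its cost\<close>

locale encoded_dendro = dendro V S E
  for V :: "'v set" and S E +
  fixes s0 :: state and vx :: "nat \<Rightarrow> 'v" and nd :: "nat \<Rightarrow> 'v set"
  assumes encodes: "encodes_dendrogram s0 vx nd V S E"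
begin

abbreviation "start \<equiv> iarr s0 ''first''"
abbreviation "stop \<equiv> iarr s0 ''last''"
abbreviation "child \<equiv> iarr s0 ''child''"
abbreviation "vertex \<equiv> iarr s0 ''vertex''"
abbreviation "top_node \<equiv> ivar s0 ''root''"
abbreviation "seg i \<equiv> {start i..<stop i}"

lemma vx_bij: "bij_betw vx {..<card V} V"
  and nd_bij: "bij_betw nd {..<card S} S"
  and root_less: "top_node < card S" and nd_root: "nd top_node = V"
  and child_less: "i < card S \<Longrightarrow> j \<in> seg i \<Longrightarrow> child j < card S"
  and child_bij: "i < card S \<Longrightarrow> bij_betw (\<lambda>j. nd (child j)) (seg i) (E `` {nd i})"
  and leaf_vertex: "i < card S \<Longrightarrow> E `` {nd i} = {} \<Longrightarrow> vertex i < card V \<and> nd i = {vx (vertex i)}"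
  using encodes by (simp_all add: encodes_dendrogram_def)

lemma nd_eq_iff: "i < card S \<Longrightarrow> i' < card S \<Longrightarrow> nd i = nd i' \<longleftrightarrow> i = i'"
  using nd_bij by (auto simp: bij_betw_def inj_on_def)

lemma child_edge: "i < card S \<Longrightarrow> j \<in> seg i \<Longrightarrow> (nd i, nd (child j)) \<in> E"
  using child_bij[of i] by (auto simp: bij_betw_def)

lemma child_inj: "i < card S \<Longrightarrow> j \<in> seg i \<Longrightarrow> j' \<in> seg i \<Longrightarrow> child j = child j' \<Longrightarrow> j = j'"
  using child_bij[of i] by (auto simp: bij_betw_def inj_on_def)

lemma seg_nonempty: "i < card S \<Longrightarrow> start i < stop i \<longleftrightarrow> E `` {nd i} \<noteq> {}"
  using child_bij[of i] by (auto simp: bij_betw_def)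

definition inputs_kept :: "state \<Rightarrow> bool" where
  "inputs_kept s \<longleftrightarrow> iarr s ''first'' = start \<and> iarr s ''last'' = stop \<and>
     iarr s ''child'' = child \<and> iarr s ''vertex'' = vertex"

text \<open>
  Positions below \<open>t\<close> are in the queue, those below \<open>h\<close> have been expanded, and of the children
  of position \<open>h\<close> those listed before \<open>j\<close> have been appended.
\<close>

definition queue_inv :: "(nat \<Rightarrow> nat) \<Rightarrow> (nat \<Rightarrow> nat) \<Rightarrow> nat \<Rightarrow> nat \<Rightarrow> nat \<Rightarrow> bool" where
  "queue_inv ord par h j t \<longleftrightarrow>
     0 < t \<and> h \<le> t \<and> ord 0 = top_node \<and> par 0 = 0 \<and>
     ord ` {..<t} \<subseteq> {..<card S} \<and> inj_on ord {..<t} \<and>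
     (\<forall>p. 0 < p \<and> p < t \<longrightarrow> par p < p \<and> par p \<le> h \<and>
        (\<exists>i\<in>seg (ord (par p)). ord p = child i \<and> (par p = h \<longrightarrow> i < j))) \<and>
     (\<forall>p<h. \<forall>i\<in>seg (ord p). child i \<in> ord ` {..<t}) \<and>
     (\<forall>i. start (ord h) \<le> i \<and> i < j \<longrightarrow> child i \<in> ord ` {..<t})"

text \<open>Queue entries are distinct node numbers. The bound makes \<open>card S\<close> minus the
  queue length usable as a potential for the time analysis.\<close>

lemma queue_inv_le_card:
  assumes "queue_inv ord par h j t"
  shows "t \<le> card S"
  using card_inj_on_le[of ord "{..<t}" "{..<card S}"] assms by (simp add: queue_inv_def)

lemma queue_inv_init: "queue_inv (f(0 := top_node)) (g(0 := 0)) 0 0 1"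
  using root_less by (auto simp: queue_inv_def inj_on_def)

text \<open>The index 0 stands for an untouched head: as no list index is below 0, no queued
  position has parent \<open>h\<close> yet.\<close>

lemma queue_inv_enter:
  "queue_inv ord par h 0 t \<Longrightarrow> queue_inv ord par h (start (ord h)) t"
  by (auto simp: queue_inv_def)

text \<open>The index may be reset to 0 because all stored parents are at most \<open>h\<close>, so
  none equals \<open>Suc h\<close>.\<close>

lemma queue_inv_leave:
  assumes "queue_inv ord par h j t" "h < t" "stop (ord h) \<le> j"
  shows "queue_inv ord par (Suc h) 0 t"
  using assms by (fastforce simp: queue_inv_def less_Suc_eq)

lemma queue_inv_append:
  assumes inv: "queue_inv ord par h j t" and "h < t" and j: "start (ord h) \<le> j" "j < stop (ord h)"
  shows "queue_inv (ord(t := child j)) (par(t := h)) h (Suc j) (Suc t)"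
proof -
  have ord: "ord p < card S" if "p < t" for p
    using inv that by (auto simp: queue_inv_def)
  have seg: "j \<in> seg (ord h)"
    using j by simp
  have queued: "par p < p" "par p \<le> h"
    "\<exists>i\<in>seg (ord (par p)). ord p = child i \<and> (par p = h \<longrightarrow> i < j)" if "0 < p" "p < t" for p
    using inv that unfolding queue_inv_def by blast+
  have inj: "inj_on ord {..<t}"
    using inv by (simp add: queue_inv_def)
  \<comment> \<open>An earlier copy would have the same parent node, hence the same parent position
    \<open>h\<close> by injectivity of \<open>ord\<close>; it would then be listed before
    \<open>j\<close>, although children are listed without repetition. The root is no child at
    all.\<close>
  have new: "child j \<noteq> ord p" if p: "p < t" for p
  proof
    assume eq: "child j = ord p"
    have edge: "(nd (ord h), nd (ord p)) \<in> E"
      using child_edge[OF ord[OF \<open>h < t\<close>] seg] eq by simp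
    show False
    proof (cases "p = 0")
      case True
      then show False
        using edge inv nd_root no_parent_root by (auto simp: queue_inv_def)
    next
      case False
      then obtain i where i: "i \<in> seg (ord (par p))" "ord p = child i" "par p = h \<longrightarrow> i < j"
        using queued(3)[of p] p by auto
      have "par p < t"
        using queued(1)[of p] False p by simp
      then have "(nd (ord (par p)), nd (ord p)) \<in> E"
        using child_edge[OF ord i(1)] i(2) by simp
      then have "ord (par p) = ord h"
        using parent_unique[OF edge] nd_eq_iff ord \<open>par p < t\<close> \<open>h < t\<close> by metis
      then have "par p = h"
        using inj \<open>par p < t\<close> \<open>h < t\<close> by (simp add: inj_on_def)
      then show False
        using child_inj[OF ord[OF \<open>h < t\<close>] seg, of i] i eq by auto
    qed
  qed
  have image: "(ord(t := child j)) ` {..<Suc t} = insert (child j) (ord ` {..<t})"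
    by (auto simp: lessThan_Suc)
  have "inj_on (ord(t := child j)) {..<Suc t}"
    using inj new new[symmetric] unfolding inj_on_def
    by (metis fun_upd_apply lessThan_iff less_Suc_eq)
  moreover have "0 < t"
    using \<open>h < t\<close> by simp
  moreover have "(par(t := h)) p < p \<and> (par(t := h)) p \<le> h \<and>
      (\<exists>i\<in>seg ((ord(t := child j)) ((par(t := h)) p)).
        (ord(t := child j)) p = child i \<and> ((par(t := h)) p = h \<longrightarrow> i < Suc j))"
    if "0 < p" "p < Suc t" for p
  proof (cases "p = t")
    case True
    then show ?thesis
      using \<open>h < t\<close> seg by (auto intro!: bexI[of _ j])
  next
    case False
    then have "p < t"
      using that by simp
    then show ?thesis
      using queued[of p] that by fastforce
  qed
  moreover have "child i \<in> insert (child j) (ord ` {..<t})"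
    if "start (ord h) \<le> i" "i < Suc j" for i
    using inv that by (cases "i = j") (auto simp: queue_inv_def)
  ultimately show ?thesis
    using inv \<open>h < t\<close> child_less[OF ord[OF \<open>h < t\<close>] seg]
    unfolding queue_inv_def image by auto
qed

text \<open>With all positions expanded, the queue contains the root and is closed under taking
  children, so it reaches every node.\<close>

lemma queue_inv_final:
  assumes inv: "queue_inv ord par t 0 t"
  shows "t = card S" and "ordered_dendro V S E (\<lambda>p. nd (ord p)) par"
proof -
  have ord: "ord p < card S" if "p < t" for p
    using inv that by (auto simp: queue_inv_def)
  have inj: "inj_on ord {..<t}" and "ord 0 = top_node" and "0 < t"
    using inv by (simp_all add: queue_inv_def)
  have par: "par p < p" "(nd (ord (par p)), nd (ord p)) \<in> E" if p: "0 < p" "p < t" for p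
  proof -
    obtain i where "par p < p" "i \<in> seg (ord (par p))" "ord p = child i"
      using inv p unfolding queue_inv_def by blast
    then show "par p < p" "(nd (ord (par p)), nd (ord p)) \<in> E"
      using child_edge[OF ord[of "par p"]] p by auto
  qed
  have "\<exists>p<t. C = nd (ord p)" if "(V, C) \<in> E\<^sup>*" for C
    using that
  proof (induction rule: rtrancl_induct)
    case base
    show ?case
      using \<open>ord 0 = top_node\<close> \<open>0 < t\<close> nd_root by metis
  next
    case (step C D)
    then obtain p where p: "p < t" "C = nd (ord p)"
      by blast
    then have "D \<in> (\<lambda>j. nd (child j)) ` seg (ord p)"
      using child_bij[OF ord[OF p(1)]] step.hyps by (simp add: bij_betw_def)
    then obtain i where i: "i \<in> seg (ord p)" "D = nd (child i)"
      by blast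
    then have "child i \<in> ord ` {..<t}"
      using inv p unfolding queue_inv_def by blast
    then show ?case
      using i by auto
  qed
  then have surj: "\<exists>p<t. C = nd (ord p)" if "C \<in> S" for C
    using reachable that by blast
  have "bij_betw (\<lambda>p. nd (ord p)) {..<t} S"
    unfolding bij_betw_def
  proof
    show "inj_on (\<lambda>p. nd (ord p)) {..<t}"
      using inj ord nd_eq_iff by (auto simp: inj_on_def)
    show "(\<lambda>p. nd (ord p)) ` {..<t} = S"
      using surj ord nd_bij by (auto simp: bij_betw_def)
  qed
  then show t: "t = card S"
    using bij_betw_same_card by fastforce
  show "ordered_dendro V S E (\<lambda>p. nd (ord p)) par"
  proof unfold_locales
    show "bij_betw (\<lambda>p. nd (ord p)) {..<card S} S"
      using \<open>bij_betw _ {..<t} S\<close> t by simp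
    show "nd (ord 0) = V"
      using \<open>ord 0 = top_node\<close> nd_root by simp
    show "par p < p" if "0 < p" "p < card S" for p
      using par(1) that t by simp
    show "E `` {nd (ord p)} = (\<lambda>p. nd (ord p)) ` {c. 0 < c \<and> c < card S \<and> par c = p}"
      if p: "p < card S" for p
    proof (intro set_eqI iffI)
      fix D
      assume "D \<in> E `` {nd (ord p)}"
      then have edge: "(nd (ord p), D) \<in> E"
        by simp
      then obtain c where c: "c < t" "D = nd (ord c)"
        using surj edge_nodes by blast
      have "0 < c"
        using edge c no_parent_root nd_root \<open>ord 0 = top_node\<close> by (cases c) auto
      then have "nd (ord (par c)) = nd (ord p)" "par c < t"
        using par[of c] parent_unique edge c by auto
      then have "par c = p"
        using nd_eq_iff ord inj p t by (auto simp: inj_on_def)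
      then show "D \<in> (\<lambda>p. nd (ord p)) ` {c. 0 < c \<and> c < card S \<and> par c = p}"
        using c \<open>0 < c\<close> t by auto
    qed (use par t in auto)
  qed
qed

lemma search_correct:
  assumes "inputs_kept s" "ivar s ''root'' = top_node"
    and budget: "44 * card S + 17 + b \<le> x"
    and post: "\<And>s x. inputs_kept s \<Longrightarrow> ivar s ''head'' = card S \<Longrightarrow> ivar s ''tail'' = card S \<Longrightarrow>
      ordered_dendro V S E (\<lambda>p. nd (iarr s ''ord'' p)) (iarr s ''par'') \<Longrightarrow> iarr s ''par'' 0 = 0 \<Longrightarrow>
      iarr s ''ord'' ` {..<card S} \<subseteq> {..<card S} \<Longrightarrow> \<forall>p<card S. rarr s ''acc'' p = 0 \<Longrightarrow>
      b \<le> x \<Longrightarrow> Q s x"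
  shows "wp f search Q s x"
proof -
  define inv where "inv h j s \<longleftrightarrow> inputs_kept s \<and> ivar s ''head'' = h \<and>
    queue_inv (iarr s ''ord'') (iarr s ''par'') h j (ivar s ''tail'') \<and>
    (\<forall>p<ivar s ''tail''. rarr s ''acc'' p = 0)" for h j s
  \<comment> \<open>24 is the exact cost of one append with its guard. An outer iteration without
    its appends costs 18, covered by 20; the 4 pays for the last outer guard.\<close>
  define outer where "outer s x \<longleftrightarrow> inv (ivar s ''head'') 0 s \<and>
    24 * (card S - ivar s ''tail'') + 20 * (card S - ivar s ''head'') + 4 + b \<le> x" for s x
  \<comment> \<open>The 4 on the right is 8 - 4: the outer guard and the assignment to
    \<open>j\<close> have already spent 8, and 4 stay reserved for the last outer guard.\<close>
  define inner where "inner h s x \<longleftrightarrow> inv h (ivar s ''j'') s \<and> h < ivar s ''tail'' \<and>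
    start (iarr s ''ord'' h) \<le> ivar s ''j'' \<and>
    24 * (card S - ivar s ''tail'') + 20 * (card S - h) + b \<le> x + 4" for h s x
  have bound: "ivar s ''tail'' \<le> card S" if "inv h j s" for h j s
    using that queue_inv_le_card by (auto simp: inv_def)
  have "outer (s\<lparr>iarr := (iarr s)(''ord'' := (iarr s ''ord'')(0 := top_node), ''par'' := (iarr s ''par'')(0 := 0)),
      rarr := (rarr s)(''acc'' := (rarr s ''acc'')(0 := 0)),
      ivar := (ivar s)(''head'' := 0, ''tail'' := 1)\<rparr>) (x - 13)"
    using assms(1) budget queue_inv_init by (simp add: outer_def inv_def inputs_kept_def)
  moreover have "wp f append_children (wp f (IAssign ''head'' (IAdd (IVar ''head'') (IConst 1))) outer) s x"
    if "inner h s x" for h s x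
    unfolding append_children_def
  proof (rule wp_Loop[where I = "inner h"])
    let ?b = "ILess (IVar ''j'') (IGet ''last'' (IGet ''ord'' (IVar ''head'')))"
    fix s x
    assume I: "inner h s x"
    have h: "h < ivar s ''tail''" "ivar s ''head'' = h" "inputs_kept s" "ivar s ''tail'' \<le> card S"
      and queue: "queue_inv (iarr s ''ord'') (iarr s ''par'') h (ivar s ''j'') (ivar s ''tail'')"
      using I bound by (auto simp: inner_def inv_def)
    show "1 + bcost ?b \<le> x"
      using I h by (auto simp: inner_def)
    {
      assume "bval s ?b"
      then have "queue_inv ((iarr s ''ord'')(ivar s ''tail'' := child (ivar s ''j'')))
          ((iarr s ''par'')(ivar s ''tail'' := h)) h (Suc (ivar s ''j'')) (Suc (ivar s ''tail''))"
        using I h queue_inv_append[OF queue] by (simp add: inner_def inputs_kept_def)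
      \<comment> \<open>The invariant after the append shows that there was room before it, so the
        truncated difference really drops by one.\<close>
      moreover from queue_inv_le_card[OF this] have "ivar s ''tail'' < card S"
        by simp
      ultimately show "wp f
       (IPut ''ord'' (IVar ''tail'') (IGet ''child'' (IVar ''j'')) ;;
        IPut ''par'' (IVar ''tail'') (IVar ''head'') ;;
        RPut ''acc'' (IVar ''tail'') (RConst 0) ;;
        IAssign ''tail'' (IAdd (IVar ''tail'') (IConst 1)) ;;
        IAssign ''j'' (IAdd (IVar ''j'') (IConst 1))) (inner h) s (x - (1 + bcost ?b))"
        using I h by (auto simp: wp_simps inner_def inv_def inputs_kept_def less_Suc_eq)
    next
      assume "\<not> bval s ?b"
      then have "queue_inv (iarr s ''ord'') (iarr s ''par'') (Suc h) 0 (ivar s ''tail'')"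
        using h queue_inv_leave[OF queue] by (simp add: inputs_kept_def)
      then show "wp f (IAssign ''head'' (IAdd (IVar ''head'') (IConst 1))) outer s (x - (1 + bcost ?b))"
        using I h by (auto simp: wp_simps outer_def inner_def inv_def inputs_kept_def)
    }
  qed (use that in simp)
  note inner_loop = this
  have "wp f (Loop (ILess (IVar ''head'') (IVar ''tail''))
     (IAssign ''j'' (IGet ''first'' (IGet ''ord'' (IVar ''head''))) ;;
      append_children ;;
      IAssign ''head'' (IAdd (IVar ''head'') (IConst 1)))) Q s x" (is "wp f (Loop ?b ?c) Q s x")
    if "outer s x" for s x
  proof (rule wp_Loop[where I = outer])
    fix s x
    assume I: "outer s x"
    have queue: "queue_inv (iarr s ''ord'') (iarr s ''par'') (ivar s ''head'') 0 (ivar s ''tail'')"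
      and inputs: "inputs_kept s" and tail: "ivar s ''tail'' \<le> card S"
      using I bound by (auto simp: outer_def inv_def)
    show "1 + bcost ?b \<le> x"
      using I by (simp add: outer_def)
    {
      assume b: "bval s ?b"
      have "inner (ivar s ''head'')
         (s\<lparr>ivar := (ivar s)(''j'' := start (iarr s ''ord'' (ivar s ''head'')))\<rparr>) (x - 8)"
        using I b tail inputs queue_inv_enter[OF queue]
        by (auto simp: inner_def outer_def inv_def inputs_kept_def)
      then have "wp f append_children (wp f (IAssign ''head'' (IAdd (IVar ''head'') (IConst 1))) outer)
       (s\<lparr>ivar := (ivar s)(''j'' := start (iarr s ''ord'' (ivar s ''head'')))\<rparr>) (x - 8)"
        by (rule inner_loop)
      then show "wp f ?c outer s (x - (1 + bcost ?b))"
        using I b tail inputs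
        by (auto simp: wp_Seq wp_IAssign[of _ "''j''"] outer_def inputs_kept_def
            simp del: One_nat_def plus_1_eq_Suc)
    next
      assume "\<not> bval s ?b"
      then have head: "ivar s ''head'' = ivar s ''tail''"
        using queue by (simp add: queue_inv_def)
      \<comment> \<open>Here the program learns the number of nodes.\<close>
      then have t: "ivar s ''tail'' = card S"
        using queue_inv_final(1) queue by simp
      show "Q s (x - (1 + bcost ?b))"
      proof (rule post)
        show "ordered_dendro V S E (\<lambda>p. nd (iarr s ''ord'' p)) (iarr s ''par'')"
          using queue_inv_final(2) queue head by simp
      qed (use I queue head t in \<open>auto simp: outer_def inv_def queue_inv_def\<close>)
    }
  qed (use that in simp)
  ultimately show ?thesis
    unfolding search_def wp_Seq
    using assms(2) budget
    by (auto simp: wp_IAssign wp_IPut wp_RPut simp del: One_nat_def plus_1_eq_Suc)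
qed

end

section \<open>The backward and the forward pass over the completed queue\<close>

locale queued_dendro =
  encoded_dendro V S E s0 vx nd + ordered_dendro V S E "\<lambda>p. nd (ord p)" par
  for V :: "'v set" and S E s0 vx nd ord par +
  assumes ord_less: "ord ` {..<card S} \<subseteq> {..<card S}" and par_root: "par 0 = 0"
begin

definition kept :: "state \<Rightarrow> bool" where
  "kept s \<longleftrightarrow> inputs_kept s \<and> iarr s ''ord'' = ord \<and> iarr s ''par'' = par \<and> ivar s ''tail'' = card S"

lemma segment_nonempty: "p < card S \<Longrightarrow> start (ord p) < stop (ord p) \<longleftrightarrow> ch p \<noteq> {}"
  using seg_nonempty[of "ord p"] N_ch[of p] ord_less by auto

lemma leaf_position:
  assumes "p < card S" "ch p = {}"
  shows "vertex (ord p) < card V \<and> nd (ord p) = {vx (vertex (ord p))}"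
  using leaf_vertex[of "ord p"] N_ch[of p] ord_less assms by auto

text \<open>The effect of treating \<open>h\<close> in the backward pass: its value enters the
  accumulator of its parent and no other.\<close>

lemma sum_ch_ge:
  fixes g :: "nat \<Rightarrow> real"
  assumes "h < card S"
  shows "(\<Sum>c\<in>ch p \<inter> {h..}. g c) =
    (if 0 < h \<and> par h = p then g h else 0) + (\<Sum>c\<in>ch p \<inter> {Suc h..}. g c)"
proof (cases "0 < h \<and> par h = p")
  case True
  then have "ch p \<inter> {h..} = insert h (ch p \<inter> {Suc h..})"
    using assms by (auto simp: ch_def)
  then show ?thesis
    using True finite_ch by simp
next
  case False
  then have "h \<notin> ch p"
    by (auto simp: ch_def)
  then have "c \<in> ch p \<inter> {h..} \<longleftrightarrow> c \<in> ch p \<inter> {Suc h..}" for c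
    by (cases "c = h") auto
  then have "ch p \<inter> {h..} = ch p \<inter> {Suc h..}"
    by blast
  with False show ?thesis
    by auto
qed

lemma ascend_correct:
  assumes "kept s" "ivar s ''head'' = card S" "\<forall>p<card S. rarr s ''acc'' p = 0"
    and budget: "38 * card S + 4 + b \<le> x"
    and post: "\<And>s x. kept s \<Longrightarrow> \<forall>p<card S. iarr s ''cut'' p = cut q p \<Longrightarrow> b \<le> x \<Longrightarrow> Q s x"
  shows "wp (\<lambda>i. q (nd i)) ascend Q s x"
proof -
  let ?best = "\<lambda>c. best q (nd (ord c))"
  \<comment> \<open>38 is the cost of an iteration on the dearer, splitting branch; 4 pays for the
    last guard. An accumulator holds the children met so far, those from \<open>head\<close>
    on.\<close>
  define inv where "inv s x \<longleftrightarrow> kept s \<and> ivar s ''head'' \<le> card S \<and>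
    (\<forall>p<card S. ivar s ''head'' \<le> p \<longrightarrow> iarr s ''cut'' p = cut q p) \<and>
    (\<forall>p<ivar s ''head''. rarr s ''acc'' p = (\<Sum>c\<in>ch p \<inter> {ivar s ''head''..}. ?best c)) \<and>
    38 * ivar s ''head'' + 4 + b \<le> x" for s x
  have "ch p \<inter> {card S..} = {}" for p
    by (auto simp: ch_def)
  then have "inv s x"
    using assms by (simp add: inv_def)
  then show ?thesis
    unfolding ascend_def
  proof (rule wp_Loop[where I = inv])
    let ?b = "ILess (IConst 0) (IVar ''head'')"
    fix s x
    assume I: "inv s x"
    show "1 + bcost ?b \<le> x"
      using I by (simp add: inv_def)
    {
      assume "bval s ?b"
      then obtain h where h: "ivar s ''head'' = Suc h"
        by (auto simp: gr0_conv_Suc)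
      then have "h < card S"
        using I by (simp add: inv_def)
      \<comment> \<open>All children of \<open>h\<close> have larger positions, so its accumulator
        is complete when \<open>h\<close> is reached.\<close>
      have "ch h \<inter> {Suc h..} = ch h"
        using par_less by (auto simp: ch_def Suc_le_eq)
      then have acc: "rarr s ''acc'' h = (\<Sum>c\<in>ch h. ?best c)"
        using I h by (simp add: inv_def)
      have cut: "cut q h = 0 \<longleftrightarrow> start (ord h) < stop (ord h) \<and> q (nd (ord h)) < rarr s ''acc'' h"
        using segment_nonempty[OF \<open>h < card S\<close>] by (simp add: cut_def acc)
      have best: "?best h = (if cut q h = 0 then rarr s ''acc'' h else q (nd (ord h)))"
        using best_position[OF \<open>h < card S\<close>] acc by simp
      have cut': "cut q h = 0 \<or> cut q h = Suc h"
        by (simp add: cut_def)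
      show "wp (\<lambda>i. q (nd i))
       (IAssign ''head'' (ISub (IVar ''head'') (IConst 1)) ;;
        Query ''x'' (IGet ''ord'' (IVar ''head'')) ;;
        Cond (BAnd (ILess (IGet ''first'' (IGet ''ord'' (IVar ''head'')))
                          (IGet ''last'' (IGet ''ord'' (IVar ''head''))))
                   (RLess (RVar ''x'') (RGet ''acc'' (IVar ''head''))))
         (IPut ''cut'' (IVar ''head'') (IConst 0) ;;
          RAssign ''x'' (RGet ''acc'' (IVar ''head'')))
         (IPut ''cut'' (IVar ''head'') (IAdd (IVar ''head'') (IConst 1))) ;;
        RPut ''acc'' (IGet ''par'' (IVar ''head''))
          (RAdd (RGet ''acc'' (IGet ''par'' (IVar ''head''))) (RVar ''x''))) inv s (x - (1 + bcost ?b))"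
      proof (cases "cut q h = 0")
        case True
        then show ?thesis
          using I h cut best \<open>h < card S\<close> sum_ch_ge[OF \<open>h < card S\<close>, of ?best]
          by (auto simp: wp_simps inv_def kept_def inputs_kept_def le_less_Suc_eq Suc_le_eq)
      next
        case False
        then show ?thesis
          using I h cut cut' best \<open>h < card S\<close> sum_ch_ge[OF \<open>h < card S\<close>, of ?best]
          by (auto simp: wp_simps inv_def kept_def inputs_kept_def le_less_Suc_eq Suc_le_eq)
      qed
    next
      assume "\<not> bval s ?b"
      then show "Q s (x - (1 + bcost ?b))"
        using I by (intro post) (auto simp: inv_def)
    }
  qed
qed

lemma descend_correct:
  assumes "kept s" "\<forall>p<card S. iarr s ''cut'' p = cut q p"
    and budget: "33 * card S + 6 + b \<le> x"
    and post: "\<And>s x. labelled_dendro V S E (\<lambda>p. nd (ord p)) par q (iarr s ''cut'') \<Longrightarrow>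
      \<forall>p<card S. ch p = {} \<longrightarrow> iarr s ''label'' (vertex (ord p)) = iarr s ''cut'' p \<Longrightarrow> b \<le> x \<Longrightarrow> Q s x"
  shows "wp f descend Q s x"
proof -
  \<comment> \<open>The label equation at a single position, so that it can be stated while the
    array still holds \<open>cut\<close> values further on.\<close>
  define rule where "rule p l \<longleftrightarrow>
    l p = (if 0 < p \<and> 0 < l (par p) then l (par p) else cut q p)" for p and l :: "nat \<Rightarrow> nat"
  \<comment> \<open>33 is an upper bound for one iteration, as if it both inherited and wrote a
    label; 4 pays for the last guard.\<close>
  define inv where "inv s x \<longleftrightarrow> kept s \<and> ivar s ''head'' \<le> card S \<and>
    (\<forall>p<card S. ivar s ''head'' \<le> p \<longrightarrow> iarr s ''cut'' p = cut q p) \<and>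
    (\<forall>p<ivar s ''head''. rule p (iarr s ''cut'')) \<and>
    (\<forall>p<ivar s ''head''. ch p = {} \<longrightarrow> iarr s ''label'' (vertex (ord p)) = iarr s ''cut'' p) \<and>
    33 * (card S - ivar s ''head'') + 4 + b \<le> x" for s x
  have "inv (s\<lparr>ivar := (ivar s)(''head'' := 0)\<rparr>) (x - 2)"
    using assms by (auto simp: inv_def kept_def inputs_kept_def)
  then have "wp f (IAssign ''head'' (IConst 0)) inv s x"
    using budget by (simp add: wp_IAssign numeral_2_eq_2)
  moreover have "wp f (Loop (ILess (IVar ''head'') (IVar ''tail''))
     (Cond (ILess (IConst 0) (IGet ''cut'' (IGet ''par'' (IVar ''head''))))
       (IPut ''cut'' (IVar ''head'') (IGet ''cut'' (IGet ''par'' (IVar ''head''))))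
       Skip ;;
      Cond (ILess (IGet ''first'' (IGet ''ord'' (IVar ''head'')))
                  (IGet ''last'' (IGet ''ord'' (IVar ''head''))))
       Skip
       (IPut ''label'' (IGet ''vertex'' (IGet ''ord'' (IVar ''head'')))
         (IGet ''cut'' (IVar ''head''))) ;;
      IAssign ''head'' (IAdd (IVar ''head'') (IConst 1)))) Q s x" (is "wp f (Loop ?b ?c) Q s x")
    if "inv s x" for s x
    using that
  proof (rule wp_Loop[where I = inv])
    fix s x
    assume I: "inv s x"
    define h where "h = ivar s ''head''"
    show "1 + bcost ?b \<le> x"
      using I by (simp add: inv_def)
    {
      assume "bval s ?b"
      then have "h < card S"
        using I by (simp add: inv_def kept_def h_def)
      define l where "l = iarr s ''cut''"
      have par: "par h < h" if "0 < h"
        using par_less that \<open>h < card S\<close> .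
      have lh: "l h = cut q h"
        using I \<open>h < card S\<close> by (simp add: inv_def l_def h_def)
      define l' where "l' = (if 0 < l (par h) then l(h := l (par h)) else l)"
      have "rule h l'"
        using par par_root lh by (auto simp: rule_def l'_def)
      \<comment> \<open>The equation at \<open>p\<close> reads only \<open>p\<close> and
        \<open>par p\<close>, both below \<open>h\<close>, so overwriting position \<open>h\<close>
        leaves it intact.\<close>
      have "rule p l'" if "p < h" for p
      proof -
        have "rule p l"
          using I that by (simp add: inv_def l_def h_def)
        moreover have "par p < h"
          using that par_less[of p] par_root \<open>h < card S\<close> by (cases "p = 0") auto
        ultimately show ?thesis
          using that by (auto simp: rule_def l'_def)
      qed
      with \<open>rule h l'\<close> have rule: "\<forall>p<Suc h. rule p l'"
        by (simp add: less_Suc_eq)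
      \<comment> \<open>Distinct leaves have distinct vertices, so a written label is never
        overwritten.\<close>
      have vertex: "vertex (ord p) \<noteq> vertex (ord h)" if "p < h" "ch p = {}" "ch h = {}" for p
        using leaf_position[of p] leaf_position[of h] N_eq_iff[of p h] that \<open>h < card S\<close> by auto
      have labels: "\<forall>p<h. ch p = {} \<longrightarrow> iarr s ''label'' (vertex (ord p)) = l' p"
        using I by (auto simp: inv_def l_def h_def l'_def)
      have seg: "start (ord h) < stop (ord h) \<longleftrightarrow> ch h \<noteq> {}"
        using segment_nonempty \<open>h < card S\<close> .
      have cut: "\<forall>p<card S. Suc h \<le> p \<longrightarrow> l' p = cut q p"
        using I by (auto simp: inv_def l_def h_def l'_def)
      show "wp f ?c inv s (x - (1 + bcost ?b))"
      proof (cases "ch h = {}")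
        case True
        then have "\<forall>p<Suc h. ch p = {} \<longrightarrow>
            ((iarr s ''label'')(vertex (ord h) := l' h)) (vertex (ord p)) = l' p"
          using labels vertex by (auto simp: less_Suc_eq)
        then show ?thesis
          using I True seg rule cut \<open>h < card S\<close>
          by (auto simp: wp_simps inv_def kept_def inputs_kept_def h_def[symmetric] l_def[symmetric] l'_def)
      next
        case False
        then have "\<forall>p<Suc h. ch p = {} \<longrightarrow> iarr s ''label'' (vertex (ord p)) = l' p"
          using labels by (auto simp: less_Suc_eq)
        then show ?thesis
          using I False seg rule cut \<open>h < card S\<close>
          by (auto simp: wp_simps inv_def kept_def inputs_kept_def h_def[symmetric] l_def[symmetric] l'_def)
      qed
    next
      assume "\<not> bval s ?b"
      then have h: "h = card S"
        using I by (simp add: inv_def kept_def h_def)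
      show "Q s (x - (1 + bcost ?b))"
      proof (rule post)
        show "labelled_dendro V S E (\<lambda>p. nd (ord p)) par q (iarr s ''cut'')"
          using I h by unfold_locales (simp add: inv_def rule_def h_def)
      qed (use I h in \<open>auto simp: inv_def h_def\<close>)
    }
  qed
  ultimately show ?thesis
    unfolding descend_def wp_Seq by (rule wp_mono)
qed

end

section \<open>Optimality of the output and the total cost\<close>

lemma (in encoded_dendro) optimise_correct:
  assumes "additive_quality V Q q" "115 * card S + 27 \<le> x"
  shows "wp (\<lambda>i. q (nd i)) optimise
    (\<lambda>s x. is_arg_max Q (\<lambda>P. P \<in> dendrogram_partitions V S) (output_partition s vx (card V))) s0 x"
  unfolding optimise_def wp_Seq
\<comment> \<open>The budget left for the later passes: 71 = 38 + 33 per node and 10 = 4 +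
  6.\<close>
proof (rule search_correct[where b = "71 * card S + 10"])
  fix s x
  assume *: "inputs_kept s" "ivar s ''tail'' = card S"
    and order: "ordered_dendro V S E (\<lambda>p. nd (iarr s ''ord'' p)) (iarr s ''par'')"
      "iarr s ''par'' 0 = 0" "iarr s ''ord'' ` {..<card S} \<subseteq> {..<card S}"
    and ascend: "ivar s ''head'' = card S" "\<forall>p<card S. rarr s ''acc'' p = 0"
    and x: "71 * card S + 10 \<le> x"
  let ?ord = "iarr s ''ord''" and ?par = "iarr s ''par''"
  interpret ordered_dendro V S E "\<lambda>p. nd (?ord p)" ?par
    by (fact order(1))
  interpret queued_dendro V S E s0 vx nd ?ord ?par
    by unfold_locales (fact order)+
  have "kept s"
    using * by (simp add: kept_def)
  then show "wp (\<lambda>i. q (nd i)) ascend (wp (\<lambda>i. q (nd i)) descend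
    (\<lambda>s x. is_arg_max Q (\<lambda>P. P \<in> dendrogram_partitions V S) (output_partition s vx (card V)))) s x"
  proof (rule ascend_correct[OF _ ascend, where b = "33 * card S + 6"])
    fix s x
    assume cut: "kept s" "\<forall>p<card S. iarr s ''cut'' p = cut q p" and x: "33 * card S + 6 \<le> x"
    show "wp (\<lambda>i. q (nd i)) descend
      (\<lambda>s x. is_arg_max Q (\<lambda>P. P \<in> dendrogram_partitions V S) (output_partition s vx (card V))) s x"
    proof (rule descend_correct[OF cut, where b = 0])
      fix s :: state
      assume lab: "labelled_dendro V S E (\<lambda>p. nd (?ord p)) ?par q (iarr s ''cut'')"
        and label: "\<forall>p<card S. ch p = {} \<longrightarrow> iarr s ''label'' (vertex (?ord p)) = iarr s ''cut'' p"
      interpret labelled_dendro V S E "\<lambda>p. nd (?ord p)" ?par q "iarr s ''cut''"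
        by (fact lab)
      have "output_partition s vx (card V) = (\<lambda>p. nd (?ord p)) ` selected"
        by (rule output_selected[OF vx_bij]) (use leaf_position label in auto)
      then show "is_arg_max Q (\<lambda>P. P \<in> dendrogram_partitions V S) (output_partition s vx (card V))"
        using selected_arg_max assms(1) by simp
    qed (use x in simp)
  qed (use x in simp)
qed (use assms(2) in \<open>simp_all add: inputs_kept_def\<close>)

theorem theorem1:
  "\<exists>(prog :: com) (T :: nat \<Rightarrow> nat) (K :: nat \<Rightarrow> nat).
     (\<lambda>n. real (T n)) \<in> O(\<lambda>n. real n) \<and>
     (\<lambda>n. real (K n)) \<in> O(\<lambda>n. real n) \<and>
     (\<forall>(V :: 'v set) S E Q q vx nd s.
        dendrogram V S E \<longrightarrow> additive_quality V Q q \<longrightarrow> encodes_dendrogram s vx nd V S E \<longrightarrow>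
        (\<exists>t k s'. exec (\<lambda>i. q (nd i)) prog s t k s' \<and>
           t \<le> T (card V) \<and> k \<le> K (card V) \<and>
           is_arg_max Q (\<lambda>P. P \<in> dendrogram_partitions V S)
             (output_partition s' vx (card V))))"
proof -
  \<comment> \<open>115 = 44 + 38 + 33 units per node, with at most \<open>2 * n\<close> nodes, and
    27 = 17 + 4 + 6.\<close>
  define T :: "nat \<Rightarrow> nat" where "T n = 230 * n + 27" for n
  \<comment> \<open>257 = 230 + 27 absorbs the constant term once \<open>n\<close> is
    positive.\<close>
  have "eventually (\<lambda>n. norm (real (T n)) \<le> 257 * norm (real n)) at_top"
    using eventually_ge_at_top[of 1] by eventually_elim (simp add: T_def)
  then have linear: "(\<lambda>n. real (T n)) \<in> O(\<lambda>n. real n)"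
    by (rule bigoI)
  have "\<exists>t k s'. exec (\<lambda>i. q (nd i)) optimise s t k s' \<and> t \<le> T (card V) \<and> k \<le> T (card V) \<and>
      is_arg_max Q (\<lambda>P. P \<in> dendrogram_partitions V S) (output_partition s' vx (card V))"
    if dendro: "dendrogram V S E" and Q: "additive_quality V Q q" and enc: "encodes_dendrogram s vx nd V S E"
    for V :: "'v set" and S E Q q vx nd s
  proof -
    interpret encoded_dendro V S E s vx nd
      using dendro enc by unfold_locales
    have "115 * card S + 27 \<le> T (card V)"
      using card_nodes_le by (simp add: T_def)
    then obtain t k s' where "exec (\<lambda>i. q (nd i)) optimise s t k s'" "t \<le> T (card V)"
      "is_arg_max Q (\<lambda>P. P \<in> dendrogram_partitions V S) (output_partition s' vx (card V))"
      using optimise_correct[OF Q] unfolding wp_def by blast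
    then show ?thesis
      using queries_le_time le_trans by blast
  qed
  with linear show ?thesis
    by blast
qed

end
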